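(* Let $(X,Y)$ be a bivariate real random variable with joint distribution function $F_{12}$ and marginal distribution functions $F_1$ (of $X$) and $F_2$ (of $Y$), where $X$ and $Y$ have finite variances, and let $(X_1,Y_1),(X_2,Y_2)$ be i.i.d. copies of $(X,Y)$. Then the parameter $\kappa=\kappa(X,Y)$ (Bergsma's covariance) can be expressed as $$\kappa=\frac14\Big[\mathbb{E}[g_{F_{12}}(X,Y)]-2\,\mathbb{E}[g_{F_1}(X)g_{F_2}(Y)]+\mathbb{E}[g_{F_1}(X)]\,\mathbb{E}[g_{F_2}(Y)]\Big]$$ $$=\frac14\Big[\mathrm{Cov}\big(|X_1-X_2|,|Y_1-Y_2|\big)-2\,\mathrm{Cov}\big(g_{F_1}(X_1),g_{F_2}(Y_1)\big)\Big]$$ $$=\frac14\big[\mu_{12}-2\mu_3+\mu_1\mu_2\big]=\int_{\mathbb{R}}\int_{\mathbb{R}}\big[F_{12}(x,y)-F_1(x)F_2(y)\big]^2\,dx\,dy .$$ In particular, $F_{12}(x,y)=F_1(x)F_2(y)$ for all $x,y$ if and only if $\kappa=0$.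
   Context: For a distribution function $F$ on $\mathbb{R}$ with finite mean, with $Z,Z_1,Z_2$ i.i.d. $F$, define $g_F(z)=\mathbb{E}|z-Z|$, $g(F)=\mathbb{E}|Z_1-Z_2|=\mathbb{E}[g_F(Z)]$, and $$h_F(z_1,z_2)=-\tfrac12\,\mathbb{E}\big(|z_1-z_2|-|z_1-Z_2|-|Z_1-z_2|+|Z_1-Z_2|\big)=-\tfrac12\big[|z_1-z_2|-g_F(z_1)-g_F(z_2)+g(F)\big].$$ Bergsma's covariance is $\kappa(X,Y)=\mathbb{E}[h_{F_1}(X_1,X_2)\,h_{F_2}(Y_1,Y_2)]$, where $(X_1,Y_1),(X_2,Y_2)$ are i.i.d. copies of $(X,Y)$. Further, $g_{F_{12}}(x,y)=\mathbb{E}\big[|x-X_1|\,|y-Y_1|\big]$, $\mu_1=g(F_1)=\mathbb{E}|X_1-X_2|$, $\mu_2=g(F_2)=\mathbb{E}|Y_1-Y_2|$, $\mu_{12}=\mathbb{E}[g_{F_{12}}(X_2,Y_2)]=\mathbb{E}\big[|X_1-X_2|\,|Y_1-Y_2|\big]$, and $\mu_3=\mathbb{E}[g_{F_1}(X)g_{F_2}(Y)]$. *)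

theory Defs
  imports "HOL-Probability.Probability"
begin

text \<open>
  A distribution on the line or the plane is represented by its law, a probability measure on the
  Borel sets (typically \<open>distr M borel X\<close>); its distribution function is \<^const>\<open>cdf\<close> on the
  line and \<open>joint_cdf\<close> on the plane. The subscripts \<open>F\<close> below are such laws.
\<close>

definition joint_cdf :: "(real \<times> real) measure \<Rightarrow> real \<Rightarrow> real \<Rightarrow> real" where
  "joint_cdf P x y = measure P ({..x} \<times> {..y})"

definition g_fun :: "real measure \<Rightarrow> real \<Rightarrow> real" where
  "g_fun F z = (LINT w|F. \<bar>z - w\<bar>)"

text \<open>An i.i.d. pair with common law \<open>F\<close> is realised by the coordinates of \<open>F \<Otimes>\<^sub>M F\<close>.\<close>

definition h_fun :: "real measure \<Rightarrow> real \<Rightarrow> real \<Rightarrow> real" where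
  "h_fun F z1 z2 =
     - (1 / 2) * (LINT p|(F \<Otimes>\<^sub>M F).
         \<bar>z1 - z2\<bar> - \<bar>z1 - snd p\<bar> - \<bar>fst p - z2\<bar> + \<bar>fst p - snd p\<bar>)"

definition g_joint :: "(real \<times> real) measure \<Rightarrow> real \<Rightarrow> real \<Rightarrow> real" where
  "g_joint P x y = (LINT p|P. \<bar>x - fst p\<bar> * \<bar>y - snd p\<bar>)"

text \<open>
  Bergsma's covariance of \<open>X\<close> and \<open>Y\<close>; the i.i.d. copies of \<open>(X, Y)\<close> in its definition are
  \<open>(X, Y) \<circ> fst\<close> and \<open>(X, Y) \<circ> snd\<close> on the product space \<open>M \<Otimes>\<^sub>M M\<close>.
\<close>

definition bergsma_cov :: "'a measure \<Rightarrow> ('a \<Rightarrow> real) \<Rightarrow> ('a \<Rightarrow> real) \<Rightarrow> real" where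
  "bergsma_cov M X Y =
     (LINT p|(M \<Otimes>\<^sub>M M).
        h_fun (distr M borel X) (X (fst p)) (X (snd p)) *
        h_fun (distr M borel Y) (Y (fst p)) (Y (snd p)))"

definition covariance :: "'a measure \<Rightarrow> ('a \<Rightarrow> real) \<Rightarrow> ('a \<Rightarrow> real) \<Rightarrow> real" where
  "covariance M U V =
     (LINT w|M. (U w - (LINT v|M. U v)) * (V w - (LINT v|M. V v)))"

end

theory Submission
  imports Defs
begin

text \<open>
  Two ideas carry the proof: one diagonalises Bergsma's kernel, the other is its degeneracy.

  Diagonalisation. Put \<open>k\<^sub>F(z, x) = 1[z \<le> x] - F(x)\<close>. Then
  \<open>h\<^sub>F(z\<^sub>1, z\<^sub>2) = \<integral> k\<^sub>F(z\<^sub>1, x) k\<^sub>F(z\<^sub>2, x) dx\<close>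
  (\<open>h_fun_eq_integral_centred_indicator\<close>). The reason is that
  \<open>\<bar>z - w\<bar> = \<integral> (1[z \<le> x] - 1[w \<le> x])\<^sup>2 dx\<close>, so that the
  combination of four distances defining \<open>h\<^sub>F\<close> is, by polarisation, the integral of a product of
  two differences of indicators; averaging over the independent copies then replaces one indicator
  in each difference by \<open>F(x)\<close>. Insert the representation for both marginals into the definition
  of \<open>\<kappa>\<close> and exchange integrals. For fixed \<open>(x, y)\<close> the integrand is the product of
  \<open>k\<^sub>F\<^sub>1(X\<^sub>i, x) k\<^sub>F\<^sub>2(Y\<^sub>i, y)\<close> over the two independent copies \<open>i = 1, 2\<close>, so its
  expectation is the square of \<open>E[k\<^sub>F\<^sub>1(X, x) k\<^sub>F\<^sub>2(Y, y)] = F\<^sub>1\<^sub>2(x, y) - F\<^sub>1(x) F\<^sub>2(y)\<close>.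
  This is the integral formula. The exchange is legitimate because \<open>\<bar>k\<bar> \<le> 1\<close> and
  \<open>\<integral> \<bar>k\<^sub>F(z, x)\<bar> dx \<le> g\<^sub>F(z)\<close>: keeping only the first copy in \<open>x\<close> and only the second
  in \<open>y\<close> bounds everything by \<open>g\<^sub>F\<^sub>1(X\<^sub>1) g\<^sub>F\<^sub>2(Y\<^sub>2)\<close>, a product of independent integrable variables.
  If \<open>\<kappa> = 0\<close>, the difference \<open>F\<^sub>1\<^sub>2 - F\<^sub>1 F\<^sub>2\<close> vanishes almost everywhere, hence everywhere
  by right-continuity.

  Degeneracy. The expectation of \<open>h\<^sub>F(z, Z)\<close> is zero for every \<open>z\<close>, so \<open>h\<^sub>F\<^sub>2(Y\<^sub>1, Y\<^sub>2)\<close> is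
  orthogonal to every square-integrable function of a single copy. In
  \<open>\<kappa> = E[h\<^sub>F\<^sub>1(X\<^sub>1, X\<^sub>2) h\<^sub>F\<^sub>2(Y\<^sub>1, Y\<^sub>2)]\<close> only the term
  \<open>\<bar>X\<^sub>1 - X\<^sub>2\<bar>\<close> of the first factor therefore survives, and expanding the second factor against it
  gives \<open>(\<mu>\<^sub>1\<^sub>2 - 2\<mu>\<^sub>3 + \<mu>\<^sub>1\<mu>\<^sub>2) / 4\<close>. Finite variances make all the products involved integrable.
  The form with covariances is the same expression, because each of the two covariances subtracts
  \<open>\<mu>\<^sub>1\<mu>\<^sub>2\<close>: the mean of \<open>g\<^sub>F\<^sub>1(X)\<close> is \<open>\<mu>\<^sub>1\<close> and that of \<open>g\<^sub>F\<^sub>2(Y)\<close> is \<open>\<mu>\<^sub>2\<close>.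

  All computations are done with the coordinates of the product space of \<open>M\<close> with itself; the
  given i.i.d. pair on \<open>N\<close> has the same law (\<open>iid_copies_distr\<close>), so expectations carry over.
\<close>

section \<open>Square-integrable functions and product spaces\<close>

definition L2 :: "'a measure \<Rightarrow> ('a \<Rightarrow> real) \<Rightarrow> bool" where
  "L2 M f \<longleftrightarrow> f \<in> borel_measurable M \<and> integrable M (\<lambda>w. (f w)\<^sup>2)"

lemma L2_measurable: "L2 M f \<Longrightarrow> f \<in> borel_measurable M"
  by (simp add: L2_def)

lemma L2_bound:
  assumes "L2 M f" "g \<in> borel_measurable M" "\<And>w. \<bar>g w\<bar> \<le> \<bar>f w\<bar>"
  shows "L2 M g"
  unfolding L2_def
proof (intro conjI assms)
  show "integrable M (\<lambda>w. (g w)\<^sup>2)"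
    by (rule Bochner_Integration.integrable_bound[of _ "\<lambda>w. (f w)\<^sup>2"])
      (use assms in \<open>auto simp: L2_def abs_le_square_iff\<close>)
qed

lemma L2_times_integrable:
  assumes "L2 M f" "L2 M g"
  shows "integrable M (\<lambda>w. f w * g w)"
proof (rule Bochner_Integration.integrable_bound[of _ "\<lambda>w. (f w)\<^sup>2 + (g w)\<^sup>2"])
  have "\<bar>f w * g w\<bar> \<le> (f w)\<^sup>2 + (g w)\<^sup>2" for w
  proof -
    have "0 \<le> (\<bar>f w\<bar> - \<bar>g w\<bar>)\<^sup>2" by simp
    then have "2 * (\<bar>f w\<bar> * \<bar>g w\<bar>) \<le> (f w)\<^sup>2 + (g w)\<^sup>2"
      by (simp add: power2_diff)
    moreover have "0 \<le> \<bar>f w\<bar> * \<bar>g w\<bar>" by simp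
    ultimately show ?thesis unfolding abs_mult by linarith
  qed
  then show "AE w in M. norm (f w * g w) \<le> norm ((f w)\<^sup>2 + (g w)\<^sup>2)"
    by auto
qed (use assms in \<open>auto simp: L2_def\<close>)

lemma L2_add:
  assumes "L2 M f" "L2 M g"
  shows "L2 M (\<lambda>w. f w + g w)"
  using assms L2_times_integrable[OF assms] unfolding L2_def
  by (auto simp: power2_sum mult.assoc)

lemma L2_cmult: "L2 M f \<Longrightarrow> L2 M (\<lambda>w. c * f w)"
  unfolding L2_def by (auto simp: power_mult_distrib)

lemma L2_diff:
  assumes "L2 M f" "L2 M g"
  shows "L2 M (\<lambda>w. f w - g w)"
  using L2_add[OF assms(1) L2_cmult[OF assms(2), of "-1"]] by simp

lemma L2_abs: "L2 M f \<Longrightarrow> L2 M (\<lambda>w. \<bar>f w\<bar>)"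
  unfolding L2_def by auto

lemma (in finite_measure) L2_const: "L2 M (\<lambda>_. c)"
  unfolding L2_def by auto

lemma (in finite_measure) L2_integrable: "L2 M f \<Longrightarrow> integrable M f"
  unfolding L2_def using square_integrable_imp_integrable by blast

lemma (in pair_sigma_finite)
  fixes f :: "'a \<Rightarrow> real" and g :: "'b \<Rightarrow> real"
  assumes f: "integrable M1 f" and g: "integrable M2 g"
  shows integrable_tensor: "integrable (M1 \<Otimes>\<^sub>M M2) (\<lambda>p. f (fst p) * g (snd p))"
    and integral_tensor: "(LINT p|(M1 \<Otimes>\<^sub>M M2). f (fst p) * g (snd p)) = (LINT w|M1. f w) * (LINT w|M2. g w)"
proof -
  have [measurable]: "f \<in> borel_measurable M1" "g \<in> borel_measurable M2"
    using f g by auto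
  show *: "integrable (M1 \<Otimes>\<^sub>M M2) (\<lambda>p. f (fst p) * g (snd p))"
    by (rule Fubini_integrable) (use f g in \<open>auto simp: abs_mult\<close>)
  show "(LINT p|(M1 \<Otimes>\<^sub>M M2). f (fst p) * g (snd p)) = (LINT w|M1. f w) * (LINT w|M2. g w)"
    using integral_fst'[OF *] by simp
qed

context pair_prob_space begin

lemma
  fixes f :: "'a \<Rightarrow> real"
  assumes "integrable M1 f"
  shows integrable_comp_fst: "integrable (M1 \<Otimes>\<^sub>M M2) (\<lambda>p. f (fst p))"
    and integral_comp_fst: "(LINT p|(M1 \<Otimes>\<^sub>M M2). f (fst p)) = (LINT w|M1. f w)"
  using integrable_tensor[OF assms, of "\<lambda>_. 1"] integral_tensor[OF assms, of "\<lambda>_. 1"]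
  by (simp_all add: M2.prob_space)

lemma
  fixes f :: "'b \<Rightarrow> real"
  assumes "integrable M2 f"
  shows integrable_comp_snd: "integrable (M1 \<Otimes>\<^sub>M M2) (\<lambda>p. f (snd p))"
    and integral_comp_snd: "(LINT p|(M1 \<Otimes>\<^sub>M M2). f (snd p)) = (LINT w|M2. f w)"
  using integrable_tensor[of "\<lambda>_. 1", OF _ assms] integral_tensor[of "\<lambda>_. 1", OF _ assms]
  by (simp_all add: M1.prob_space)

lemma L2_comp_fst: "L2 M1 f \<Longrightarrow> L2 (M1 \<Otimes>\<^sub>M M2) (\<lambda>p. f (fst p))"
  unfolding L2_def using integrable_comp_fst[of "\<lambda>w. (f w)\<^sup>2"] by auto

lemma L2_comp_snd: "L2 M2 f \<Longrightarrow> L2 (M1 \<Otimes>\<^sub>M M2) (\<lambda>p. f (snd p))"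
  unfolding L2_def using integrable_comp_snd[of "\<lambda>w. (f w)\<^sup>2"] by auto

end

section \<open>Bergsma's kernel as an integral of centred indicators\<close>

lemma
  fixes z w :: real
  shows integrable_step_diff: "integrable lborel (\<lambda>x. of_bool (z \<le> x) - of_bool (w \<le> x) :: real)"
    and integral_abs_step_diff: "(LINT x|lborel. \<bar>of_bool (z \<le> x) - of_bool (w \<le> x) :: real\<bar>) = \<bar>z - w\<bar>"
proof -
  have a: "\<bar>of_bool (z \<le> x) - of_bool (w \<le> x) :: real\<bar> = indicat_real {min z w..<max z w} x" for x
    by (auto simp: indicator_def)
  show "(LINT x|lborel. \<bar>of_bool (z \<le> x) - of_bool (w \<le> x) :: real\<bar>) = \<bar>z - w\<bar>"
    unfolding a by simp
  show "integrable lborel (\<lambda>x. of_bool (z \<le> x) - of_bool (w \<le> x) :: real)"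
    by (rule Bochner_Integration.integrable_bound[of _ "indicat_real {min z w..<max z w}"])
      (auto simp: a)
qed

text \<open>
  Polarisation: a difference of indicators takes values in \<open>{-1, 0, 1}\<close>, so its absolute value is
  its square, and
  \<open>2 (a\<^sub>1 - b\<^sub>1) (a\<^sub>2 - b\<^sub>2) = (a\<^sub>1 - b\<^sub>2)\<^sup>2 + (b\<^sub>1 - a\<^sub>2)\<^sup>2 - (a\<^sub>1 - a\<^sub>2)\<^sup>2 - (b\<^sub>1 - b\<^sub>2)\<^sup>2\<close>.
\<close>

lemma integral_step_diff_times:
  fixes z1 w1 z2 w2 :: real
  defines "D \<equiv> (\<lambda>z w x. of_bool (z \<le> x) - of_bool (w \<le> x) :: real)"
  shows "(LINT x|lborel. D z1 w1 x * D z2 w2 x) =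
    - (1 / 2) * (\<bar>z1 - z2\<bar> - \<bar>z1 - w2\<bar> - \<bar>w1 - z2\<bar> + \<bar>w1 - w2\<bar>)"
proof -
  have i: "integrable lborel (\<lambda>x. \<bar>D z w x\<bar>)" for z w
    unfolding D_def using integrable_step_diff by simp
  have "D z1 w1 x * D z2 w2 x =
      - (1 / 2) * (\<bar>D z1 z2 x\<bar> - \<bar>D z1 w2 x\<bar> - \<bar>D w1 z2 x\<bar> + \<bar>D w1 w2 x\<bar>)" for x
    unfolding D_def by (auto simp: of_bool_def)
  then show ?thesis
    using i integral_abs_step_diff unfolding D_def[symmetric]
    by (simp add: D_def)
qed

definition centred_indicator :: "real measure \<Rightarrow> real \<Rightarrow> real \<Rightarrow> real" where
  "centred_indicator F z x = of_bool (z \<le> x) - cdf F x"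

locale mean_law = real_distribution F for F +
  assumes integrable_id: "integrable F (\<lambda>w. w)"
begin

lemma integrable_abs_diff: "integrable F (\<lambda>w. \<bar>z - w\<bar>)"
  using integrable_id by auto

lemma g_fun_measurable [measurable]: "g_fun F \<in> borel_measurable borel"
  unfolding g_fun_def by measurable

lemma cdf_measurable [measurable]: "cdf F \<in> borel_measurable borel"
  by (intro borel_measurable_mono) (auto simp: mono_def cdf_nondecreasing)

lemma g_fun_nonneg: "0 \<le> g_fun F z"
  unfolding g_fun_def by simp

text \<open>
  This linear growth is what turns a finite variance of \<open>X\<close> into square-integrability of
  \<open>g\<^sub>F(X)\<close>.
\<close>

lemma g_fun_le: "g_fun F z \<le> \<bar>z\<bar> + g_fun F 0"
proof -
  have "g_fun F z \<le> (LINT w|F. \<bar>z\<bar> + \<bar>0 - w\<bar>)"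
    unfolding g_fun_def using integrable_id by (intro integral_mono) auto
  also have "\<dots> = \<bar>z\<bar> + g_fun F 0"
    unfolding g_fun_def using integrable_id prob_space by simp
  finally show ?thesis .
qed

lemma integrable_g_fun: "integrable F (g_fun F)"
proof (rule Bochner_Integration.integrable_bound)
  show "integrable F (\<lambda>z. \<bar>z\<bar> + g_fun F 0)" using integrable_id by auto
qed (use g_fun_le g_fun_nonneg in \<open>auto simp: add_nonneg_nonneg\<close>)

sublocale FF: pair_prob_space F F ..

lemma integrable_abs_diff_pair: "integrable (F \<Otimes>\<^sub>M F) (\<lambda>p. \<bar>fst p - snd p\<bar>)"
  using FF.integrable_comp_fst[OF integrable_id] FF.integrable_comp_snd[OF integrable_id]
  by auto

lemma integral_abs_diff_pair: "(LINT p|(F \<Otimes>\<^sub>M F). \<bar>fst p - snd p\<bar>) = (LINT z|F. g_fun F z)"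
  unfolding g_fun_def using FF.integral_fst'[OF integrable_abs_diff_pair] by simp

lemma h_fun_eq:
  "h_fun F z1 z2 = - (1 / 2) * (\<bar>z1 - z2\<bar> - g_fun F z1 - g_fun F z2 + (LINT z|F. g_fun F z))"
proof -
  have 1: "integrable (F \<Otimes>\<^sub>M F) (\<lambda>p. \<bar>z1 - snd p\<bar>)" "(LINT p|(F \<Otimes>\<^sub>M F). \<bar>z1 - snd p\<bar>) = g_fun F z1"
    using FF.integrable_comp_snd[OF integrable_abs_diff] FF.integral_comp_snd[OF integrable_abs_diff]
    by (auto simp: g_fun_def)
  have 2: "integrable (F \<Otimes>\<^sub>M F) (\<lambda>p. \<bar>fst p - z2\<bar>)" "(LINT p|(F \<Otimes>\<^sub>M F). \<bar>fst p - z2\<bar>) = g_fun F z2"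
    using FF.integrable_comp_fst[OF integrable_abs_diff, of z2] FF.integral_comp_fst[OF integrable_abs_diff, of z2]
    by (auto simp: g_fun_def abs_minus_commute)
  show ?thesis
    unfolding h_fun_def using 1 2 integrable_abs_diff_pair integral_abs_diff_pair
    by (simp add: FF.prob_space)
qed

lemma h_fun_measurable [measurable]:
  assumes [measurable]: "f \<in> borel_measurable N" "f' \<in> borel_measurable N"
  shows "(\<lambda>p. h_fun F (f p) (f' p)) \<in> borel_measurable N"
  unfolding h_fun_eq by measurable

lemma h_fun_commute: "h_fun F z1 z2 = h_fun F z2 z1"
  unfolding h_fun_eq by (simp add: abs_minus_commute algebra_simps)

text \<open>
  Degeneracy of the kernel: averaging \<open>\<bar>z\<^sub>1 - z\<^sub>2\<bar>\<close> and \<open>g\<^sub>F(z\<^sub>2)\<close> over \<open>z\<^sub>2\<close> yields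
  \<open>g\<^sub>F(z\<^sub>1)\<close> and \<open>g(F)\<close>, which cancel the other two terms.
\<close>

lemma integral_h_fun: "(LINT z2|F. h_fun F z1 z2) = 0"
  unfolding h_fun_eq using integrable_abs_diff[of z1] integrable_g_fun prob_space
  by (simp flip: g_fun_def)

lemma centred_indicator_measurable [measurable]:
  assumes [measurable]: "f \<in> borel_measurable N" "f' \<in> borel_measurable N"
  shows "(\<lambda>p. centred_indicator F (f p) (f' p)) \<in> borel_measurable N"
  unfolding centred_indicator_def by measurable

lemma abs_centred_indicator_le_1: "\<bar>centred_indicator F z x\<bar> \<le> 1"
  unfolding centred_indicator_def using cdf_nonneg[of x] cdf_bounded_prob[of x]
  by (auto simp: of_bool_def)

lemma integral_step: "(LINT w|F. of_bool (w \<le> x)) = cdf F x"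
proof -
  have "of_bool (w \<le> x) = indicat_real {..x} w" for w by (simp add: indicator_def)
  then show ?thesis by (simp add: cdf_def)
qed

lemma integrable_step: "integrable F (\<lambda>w. of_bool (w \<le> x) :: real)"
  by (rule integrable_const_bound[of _ 1]) auto

lemma centred_indicator_eq_integral:
  "centred_indicator F z x = (LINT w|F. of_bool (z \<le> x) - of_bool (w \<le> x))"
  unfolding centred_indicator_def using integrable_step integral_step prob_space by simp

text \<open>
  The centred indicator is the average over \<open>w\<close> of \<open>1[z \<le> x] - 1[w \<le> x]\<close>, whose absolute value
  integrates to \<open>\<bar>z - w\<bar>\<close> over \<open>x\<close>; averaging this distance over \<open>w\<close> gives \<open>g\<^sub>F(z)\<close>.
\<close>

lemma
  shows integrable_centred_indicator: "integrable lborel (centred_indicator F z)"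
    and integral_abs_centred_indicator_le:
      "(LINT x|lborel. \<bar>centred_indicator F z x\<bar>) \<le> g_fun F z"
proof -
  interpret FL: pair_sigma_finite F "lborel :: real measure" ..
  let ?D = "\<lambda>w x. of_bool (z \<le> x) - of_bool (w \<le> x) :: real"
  have D: "integrable (F \<Otimes>\<^sub>M lborel) (case_prod ?D)"
  proof (rule FL.Fubini_integrable)
    show "integrable F (\<lambda>w. LINT x|lborel. norm (case (w, x) of (w, x) \<Rightarrow> ?D w x))"
      using integrable_abs_diff by (simp add: integral_abs_step_diff)
  qed (auto simp: integrable_step_diff)
  show "integrable lborel (centred_indicator F z)"
    using FL.integrable_snd[OF D] by (simp add: centred_indicator_eq_integral[abs_def])
  then have "integrable lborel (\<lambda>x. \<bar>centred_indicator F z x\<bar>)" by simp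
  then have "(LINT x|lborel. \<bar>centred_indicator F z x\<bar>) \<le> (LINT x|lborel. LINT w|F. \<bar>?D w x\<bar>)"
  proof (rule integral_mono)
    show "integrable lborel (\<lambda>x. LINT w|F. \<bar>?D w x\<bar>)"
      by (rule FL.integrable_snd) (use D in \<open>auto simp: case_prod_unfold\<close>)
  qed (simp add: centred_indicator_eq_integral)
  also have "\<dots> = (LINT w|F. LINT x|lborel. \<bar>?D w x\<bar>)"
    by (rule FL.Fubini_integral) (use D in \<open>auto simp: case_prod_unfold\<close>)
  also have "\<dots> = g_fun F z"
    by (simp add: integral_abs_step_diff g_fun_def)
  finally show "(LINT x|lborel. \<bar>centred_indicator F z x\<bar>) \<le> g_fun F z" .
qed

text \<open>
  For fixed \<open>x\<close> the differences \<open>1[z\<^sub>1 \<le> x] - 1[Z\<^sub>1 \<le> x]\<close> and \<open>1[z\<^sub>2 \<le> x] - 1[Z\<^sub>2 \<le> x]\<close>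
  are independent, so once the integral over \<open>x\<close> has been moved outside the expectation, the latter
  factorises.
\<close>

lemma h_fun_eq_integral_centred_indicator:
  "h_fun F z1 z2 = (LINT x|lborel. centred_indicator F z1 x * centred_indicator F z2 x)"
proof -
  interpret L: pair_sigma_finite "F \<Otimes>\<^sub>M F" "lborel :: real measure" ..
  let ?D = "\<lambda>z w x. of_bool (z \<le> x) - of_bool (w \<le> x) :: real"
  have dom: "integrable ((F \<Otimes>\<^sub>M F) \<Otimes>\<^sub>M lborel) (\<lambda>(p, x). ?D z1 (fst p) x)"
  proof (rule L.Fubini_integrable)
    show "integrable (F \<Otimes>\<^sub>M F) (\<lambda>p. LINT x|lborel. norm (case (p, x) of (p, x) \<Rightarrow> ?D z1 (fst p) x))"
      using FF.integrable_comp_fst[OF integrable_abs_diff] by (simp add: integral_abs_step_diff)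
  qed (auto simp: integrable_step_diff)
  have int: "integrable ((F \<Otimes>\<^sub>M F) \<Otimes>\<^sub>M lborel) (\<lambda>(p, x). ?D z1 (fst p) x * ?D z2 (snd p) x)"
  proof (rule Bochner_Integration.integrable_bound[OF dom])
    have "\<bar>?D z1 w x * ?D z2 w' x\<bar> \<le> \<bar>?D z1 w x\<bar>" for w w' x
      by (auto simp: abs_mult)
    then show "AE q in (F \<Otimes>\<^sub>M F) \<Otimes>\<^sub>M lborel. norm (case q of (p, x) \<Rightarrow> ?D z1 (fst p) x * ?D z2 (snd p) x)
        \<le> norm (case q of (p, x) \<Rightarrow> ?D z1 (fst p) x)"
      by (auto simp: case_prod_unfold)
  qed measurable
  have "h_fun F z1 z2 = (LINT p|(F \<Otimes>\<^sub>M F). LINT x|lborel. ?D z1 (fst p) x * ?D z2 (snd p) x)"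
    unfolding integral_step_diff_times h_fun_def by simp
  also have "\<dots> = (LINT x|lborel. LINT p|(F \<Otimes>\<^sub>M F). ?D z1 (fst p) x * ?D z2 (snd p) x)"
    by (rule L.Fubini_integral[OF int, symmetric])
  also have "\<dots> = (LINT x|lborel. centred_indicator F z1 x * centred_indicator F z2 x)"
    unfolding centred_indicator_eq_integral using integrable_step
    by (subst FF.integral_tensor) auto
  finally show ?thesis .
qed

end


section \<open>One square-integrable random variable and its copies\<close>

lemma (in mean_law) L2_g_fun_comp:
  assumes "prob_space M" "L2 M X"
  shows "L2 M (\<lambda>w. g_fun F (X w))"
proof -
  interpret M: prob_space M by fact
  have [measurable]: "X \<in> borel_measurable M" using assms(2) by (rule L2_measurable)
  show ?thesis
  proof (rule L2_bound)
    show "L2 M (\<lambda>w. \<bar>X w\<bar> + g_fun F 0)"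
      by (intro L2_add L2_abs M.L2_const assms)
    show "\<bar>g_fun F (X w)\<bar> \<le> \<bar>\<bar>X w\<bar> + g_fun F 0\<bar>" for w
      using g_fun_le[of "X w"] g_fun_nonneg[of "X w"] by linarith
  qed measurable
qed

locale L2_variable = prob_space M for M :: "'a measure" +
  fixes X :: "'a \<Rightarrow> real"
  assumes L2_X: "L2 M X"
begin

abbreviation "F \<equiv> distr M borel X"

lemma X_measurable [measurable]: "X \<in> borel_measurable M"
  using L2_X by (rule L2_measurable)

sublocale law: mean_law F
proof (intro mean_law.intro real_distribution_distr)
  show "mean_law_axioms F"
    using L2_integrable[OF L2_X] by unfold_locales (simp add: integrable_distr_eq)
qed simp

sublocale MM: pair_prob_space M M ..

lemma g_fun_law: "g_fun F z = (LINT w|M. \<bar>z - X w\<bar>)"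
  unfolding g_fun_def by (subst integral_distr) auto

lemma integral_g_fun_law: "(LINT z|F. g_fun F z) = (LINT w|M. g_fun F (X w))"
  by (subst integral_distr) auto

lemma L2_g_fun: "L2 M (\<lambda>w. g_fun F (X w))"
  by (rule law.L2_g_fun_comp[OF prob_space_axioms L2_X])

lemma L2_abs_diff: "L2 (M \<Otimes>\<^sub>M M) (\<lambda>p. \<bar>X (fst p) - X (snd p)\<bar>)"
  by (rule L2_abs[OF L2_diff[OF MM.L2_comp_fst[OF L2_X] MM.L2_comp_snd[OF L2_X]]])

lemma L2_h_fun: "L2 (M \<Otimes>\<^sub>M M) (\<lambda>p. h_fun F (X (fst p)) (X (snd p)))"
  unfolding law.h_fun_eq
  by (rule L2_cmult[OF L2_add[OF L2_diff[OF L2_diff[OF L2_abs_diff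
          MM.L2_comp_fst[OF L2_g_fun]] MM.L2_comp_snd[OF L2_g_fun]] MM.L2_const]])

lemma integral_swap:
  fixes f :: "'a \<times> 'a \<Rightarrow> real"
  assumes "f \<in> borel_measurable (M \<Otimes>\<^sub>M M)"
  shows "(LINT p|(M \<Otimes>\<^sub>M M). f (snd p, fst p)) = (LINT p|(M \<Otimes>\<^sub>M M). f p)"
  using MM.integral_product_swap[OF assms] by (simp add: case_prod_unfold)

text \<open>
  Conditioning on the copy that \<open>\<phi>\<close> depends on: the other copy is averaged out, which turns the
  distance into \<open>g\<^sub>F\<close> and the kernel into zero. The kernel is thus orthogonal to every
  square-integrable function of one copy.
\<close>

lemma
  assumes "L2 M \<phi>"
  shows integral_fst_times_abs_diff:
      "(LINT p|(M \<Otimes>\<^sub>M M). \<phi> (fst p) * \<bar>X (fst p) - X (snd p)\<bar>) = (LINT w|M. \<phi> w * g_fun F (X w))"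
    and integral_snd_times_abs_diff:
      "(LINT p|(M \<Otimes>\<^sub>M M). \<phi> (snd p) * \<bar>X (fst p) - X (snd p)\<bar>) = (LINT w|M. \<phi> w * g_fun F (X w))"
    and integral_fst_times_h_fun:
      "(LINT p|(M \<Otimes>\<^sub>M M). \<phi> (fst p) * h_fun F (X (fst p)) (X (snd p))) = 0"
    and integral_snd_times_h_fun:
      "(LINT p|(M \<Otimes>\<^sub>M M). \<phi> (snd p) * h_fun F (X (fst p)) (X (snd p))) = 0"
proof -
  have [measurable]: "\<phi> \<in> borel_measurable M" using assms by (rule L2_measurable)
  have \<phi>: "L2 (M \<Otimes>\<^sub>M M) (\<lambda>p. \<phi> (fst p))" by (rule MM.L2_comp_fst) fact
  show 1: "(LINT p|(M \<Otimes>\<^sub>M M). \<phi> (fst p) * \<bar>X (fst p) - X (snd p)\<bar>) = (LINT w|M. \<phi> w * g_fun F (X w))"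
    using MM.integral_fst'[OF L2_times_integrable[OF \<phi> L2_abs_diff]] by (simp add: g_fun_law)
  show "(LINT p|(M \<Otimes>\<^sub>M M). \<phi> (snd p) * \<bar>X (fst p) - X (snd p)\<bar>) = (LINT w|M. \<phi> w * g_fun F (X w))"
    unfolding 1[symmetric] by (subst integral_swap[symmetric]) (auto simp: abs_minus_commute)
  have "(LINT v|M. h_fun F z (X v)) = 0" for z
    using law.integral_h_fun[of z] by (subst (asm) integral_distr) auto
  then show 2: "(LINT p|(M \<Otimes>\<^sub>M M). \<phi> (fst p) * h_fun F (X (fst p)) (X (snd p))) = 0"
    using MM.integral_fst'[OF L2_times_integrable[OF \<phi> L2_h_fun]] by simp
  show "(LINT p|(M \<Otimes>\<^sub>M M). \<phi> (snd p) * h_fun F (X (fst p)) (X (snd p))) = 0"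
    unfolding 2[symmetric] by (subst integral_swap[symmetric]) (auto simp: law.h_fun_commute)
qed

lemma integral_abs_diff: "(LINT p|(M \<Otimes>\<^sub>M M). \<bar>X (fst p) - X (snd p)\<bar>) = (LINT w|M. g_fun F (X w))"
  using integral_fst_times_abs_diff[OF L2_const[of 1]] by simp

lemma integral_h_fun_zero: "(LINT p|(M \<Otimes>\<^sub>M M). h_fun F (X (fst p)) (X (snd p))) = 0"
  using integral_fst_times_h_fun[OF L2_const[of 1]] by simp

end

section \<open>Covariances and laws of i.i.d. pairs\<close>

lemma covariance_comp:
  assumes T: "T \<in> measurable N S" and f: "f \<in> borel_measurable S" "g \<in> borel_measurable S"
  shows "covariance N (\<lambda>w. f (T w)) (\<lambda>w. g (T w)) = covariance (distr N S T) f g"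
  unfolding covariance_def using assms by (simp add: integral_distr)

lemma (in prob_space) covariance_eq:
  assumes "L2 M U" "L2 M V"
  shows "covariance M U V = (LINT w|M. U w * V w) - (LINT w|M. U w) * (LINT w|M. V w)"
proof -
  have i: "integrable M (\<lambda>w. U w * V w)" "integrable M U" "integrable M V"
    using assms by (auto intro: L2_times_integrable L2_integrable)
  have "covariance M U V = (LINT w|M. U w * V w - (LINT v|M. V v) * U w
      - (LINT v|M. U v) * V w + (LINT v|M. U v) * (LINT v|M. V v))"
    unfolding covariance_def by (intro Bochner_Integration.integral_cong) (auto simp: algebra_simps)
  also have "\<dots> = (LINT w|M. U w * V w) - (LINT w|M. U w) * (LINT w|M. V w)"
    using i by (simp add: prob_space)
  finally show ?thesis .
qed

text \<open>
  Any i.i.d. pair with the law of \<open>W\<close> has the joint law of the two coordinate copies of \<open>W\<close> on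
  the product space, so expectations of functions of the pair may be computed there.
\<close>

lemma iid_copies_distr:
  assumes M: "prob_space M" and N: "prob_space N" and W: "W \<in> measurable M S"
    and ind: "prob_space.indep_var N S W1 S W2"
    and law: "distr N S W1 = distr M S W" "distr N S W2 = distr M S W"
  shows "distr N (S \<Otimes>\<^sub>M S) (\<lambda>w. (W1 w, W2 w)) =
    distr (M \<Otimes>\<^sub>M M) (S \<Otimes>\<^sub>M S) (\<lambda>p. (W (fst p), W (snd p)))"
proof -
  interpret M: prob_space M by fact
  interpret W: prob_space "distr M S W" by (rule M.prob_space_distr[OF W])
  have "distr N (S \<Otimes>\<^sub>M S) (\<lambda>w. (W1 w, W2 w)) = distr M S W \<Otimes>\<^sub>M distr M S W"
    using ind prob_space.indep_var_distribution_eq[OF N] law by metis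
  also have "\<dots> = distr (M \<Otimes>\<^sub>M M) (S \<Otimes>\<^sub>M S) (\<lambda>(v, w). (W v, W w))"
    by (rule pair_measure_distr[OF W W]) unfold_locales
  finally show ?thesis by (simp add: case_prod_unfold)
qed

section \<open>Two square-integrable random variables\<close>

lemma point_of_AE_in_square:
  assumes "AE q in lborel. P (fst q) (snd q)" and "e > 0"
  obtains x' y' :: real where "x < x'" "x' < x + e" "y < y'" "y' < y + e" "P x' y'"
proof (rule ccontr)
  assume no: "\<not> thesis"
  let ?S = "{x<..<x + e} \<times> {y<..<y + e}"
  have "AE q in lborel \<Otimes>\<^sub>M lborel. q \<notin> ?S"
    using assms(1) unfolding lborel_prod
    by eventually_elim (use no that in \<open>auto simp: mem_Times_iff\<close>)
  then have "?S \<in> null_sets (lborel \<Otimes>\<^sub>M lborel)"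
    by (subst (asm) AE_iff_null_sets[symmetric]) auto
  moreover have "emeasure (lborel \<Otimes>\<^sub>M lborel) ?S = ennreal (e * e)"
    using \<open>e > 0\<close> by (subst lborel.emeasure_pair_measure_Times) (auto simp: ennreal_mult)
  ultimately show False using \<open>e > 0\<close> by (auto simp: null_sets_def)
qed

locale L2_pair = prob_space M + X: L2_variable M X + Y: L2_variable M Y
  for M :: "'a measure" and X Y :: "'a \<Rightarrow> real"
begin

abbreviation "H \<equiv> distr M borel (\<lambda>w. (X w, Y w))"
abbreviation "defect x y \<equiv> joint_cdf H x y - cdf X.F x * cdf Y.F y"

lemma XY_measurable [measurable]: "(\<lambda>w. (X w, Y w)) \<in> measurable M borel"
  by (simp flip: borel_prod)

text \<open>
  Only the distance term of the first kernel contributes, since the second kernel is orthogonal to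
  functions of a single copy; this leaves a product of a distance with a kernel, whose four terms
  are then evaluated by conditioning.
\<close>

lemma bergsma_cov_eq_abs_diff_moments:
  "bergsma_cov M X Y = 1 / 4 *
    ((LINT p|(M \<Otimes>\<^sub>M M). \<bar>X (fst p) - X (snd p)\<bar> * \<bar>Y (fst p) - Y (snd p)\<bar>)
     - 2 * (LINT w|M. g_fun X.F (X w) * g_fun Y.F (Y w))
     + (LINT w|M. g_fun X.F (X w)) * (LINT w|M. g_fun Y.F (Y w)))"
proof -
  let ?a = "\<lambda>p. \<bar>X (fst p) - X (snd p)\<bar>" and ?b = "\<lambda>p. \<bar>Y (fst p) - Y (snd p)\<bar>"
  let ?h = "\<lambda>p. h_fun Y.F (Y (fst p)) (Y (snd p))"
  let ?gX = "\<lambda>w. g_fun X.F (X w)" and ?gY = "\<lambda>w. g_fun Y.F (Y w)"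
  let ?\<mu> = "LINT w|M. ?gX w" and ?\<nu> = "LINT w|M. ?gY w"
  have iX: "integrable (M \<Otimes>\<^sub>M M) (\<lambda>p. ?a p * ?h p)"
    "integrable (M \<Otimes>\<^sub>M M) (\<lambda>p. ?gX (fst p) * ?h p)"
    "integrable (M \<Otimes>\<^sub>M M) (\<lambda>p. ?gX (snd p) * ?h p)"
    "integrable (M \<Otimes>\<^sub>M M) ?h"
    by (rule L2_times_integrable[OF X.L2_abs_diff Y.L2_h_fun]
        L2_times_integrable[OF X.MM.L2_comp_fst[OF X.L2_g_fun] Y.L2_h_fun]
        L2_times_integrable[OF X.MM.L2_comp_snd[OF X.L2_g_fun] Y.L2_h_fun]
        X.MM.L2_integrable[OF Y.L2_h_fun])+
  have iY: "integrable (M \<Otimes>\<^sub>M M) (\<lambda>p. ?a p * ?b p)"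
    "integrable (M \<Otimes>\<^sub>M M) (\<lambda>p. ?gY (fst p) * ?a p)"
    "integrable (M \<Otimes>\<^sub>M M) (\<lambda>p. ?gY (snd p) * ?a p)"
    "integrable (M \<Otimes>\<^sub>M M) ?a"
    by (rule L2_times_integrable[OF X.L2_abs_diff Y.L2_abs_diff]
        L2_times_integrable[OF X.MM.L2_comp_fst[OF Y.L2_g_fun] X.L2_abs_diff]
        L2_times_integrable[OF X.MM.L2_comp_snd[OF Y.L2_g_fun] X.L2_abs_diff]
        X.MM.L2_integrable[OF X.L2_abs_diff])+
  have "bergsma_cov M X Y = (LINT p|(M \<Otimes>\<^sub>M M).
      - (1 / 2) * (?a p * ?h p - ?gX (fst p) * ?h p - ?gX (snd p) * ?h p + ?\<mu> * ?h p))"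
    unfolding bergsma_cov_def X.law.h_fun_eq X.integral_g_fun_law
    by (intro Bochner_Integration.integral_cong) (auto simp: algebra_simps)
  also have "\<dots> = - (1 / 2) * (LINT p|(M \<Otimes>\<^sub>M M). ?a p * ?h p)"
    using iX Y.integral_fst_times_h_fun[OF X.L2_g_fun] Y.integral_snd_times_h_fun[OF X.L2_g_fun]
      Y.integral_h_fun_zero by simp
  also have "(LINT p|(M \<Otimes>\<^sub>M M). ?a p * ?h p) = (LINT p|(M \<Otimes>\<^sub>M M).
      - (1 / 2) * (?a p * ?b p - ?gY (fst p) * ?a p - ?gY (snd p) * ?a p + ?\<nu> * ?a p))"
    unfolding Y.law.h_fun_eq Y.integral_g_fun_law
    by (intro Bochner_Integration.integral_cong) (auto simp: algebra_simps)
  also have "\<dots> = - (1 / 2) * ((LINT p|(M \<Otimes>\<^sub>M M). ?a p * ?b p)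
      - 2 * (LINT w|M. ?gX w * ?gY w) + ?\<mu> * ?\<nu>)"
    using iY X.integral_fst_times_abs_diff[OF Y.L2_g_fun] X.integral_snd_times_abs_diff[OF Y.L2_g_fun]
      X.integral_abs_diff by (simp add: mult.commute)
  finally show ?thesis by simp
qed

lemma integral_g_joint:
  "(LINT w|M. g_joint H (X w) (Y w)) =
    (LINT p|(M \<Otimes>\<^sub>M M). \<bar>X (fst p) - X (snd p)\<bar> * \<bar>Y (fst p) - Y (snd p)\<bar>)"
proof -
  have "g_joint H x y = (LINT v|M. \<bar>x - X v\<bar> * \<bar>y - Y v\<bar>)" for x y
    unfolding g_joint_def by (subst integral_distr) (auto simp flip: borel_prod)
  then show ?thesis
    using X.MM.integral_fst'[OF L2_times_integrable[OF X.L2_abs_diff Y.L2_abs_diff]] by simp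
qed

lemma joint_cdf_eq_prob: "joint_cdf H x y = prob {w \<in> space M. X w \<le> x \<and> Y w \<le> y}"
proof -
  have "{..x} \<times> {..y} \<in> sets (borel \<Otimes>\<^sub>M borel)" by auto
  then have "{..x} \<times> {..y} \<in> sets (borel :: (real \<times> real) measure)"
    by (simp only: borel_prod)
  then show ?thesis
    unfolding joint_cdf_def
    by (subst measure_distr) (auto intro!: arg_cong[where f = prob])
qed

lemma cdf_X_eq_prob: "cdf X.F x = prob {w \<in> space M. X w \<le> x}"
  unfolding cdf_def by (subst measure_distr) (auto intro!: arg_cong[where f = prob])

lemma cdf_Y_eq_prob: "cdf Y.F y = prob {w \<in> space M. Y w \<le> y}"
  unfolding cdf_def by (subst measure_distr) (auto intro!: arg_cong[where f = prob])

text \<open>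
  For each \<open>(x, y)\<close>, the difference between \<open>F\<^sub>1\<^sub>2(x, y)\<close> and \<open>F\<^sub>1(x) F\<^sub>2(y)\<close> is the covariance of
  the indicators of \<open>X \<le> x\<close> and \<open>Y \<le> y\<close>.
\<close>

lemma integral_centred_indicators:
  "(LINT w|M. centred_indicator X.F (X w) x * centred_indicator Y.F (Y w) y) = defect x y"
proof -
  let ?A = "{w \<in> space M. X w \<le> x}" and ?B = "{w \<in> space M. Y w \<le> y}"
  have "(LINT w|M. centred_indicator X.F (X w) x * centred_indicator Y.F (Y w) y) =
    (LINT w|M. indicat_real (?A \<inter> ?B) w - cdf Y.F y * indicat_real ?A w
       - cdf X.F x * indicat_real ?B w + cdf X.F x * cdf Y.F y)"
    unfolding centred_indicator_def
    by (intro Bochner_Integration.integral_cong) (auto simp: algebra_simps indicator_def of_bool_def)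
  also have "\<dots> = prob (?A \<inter> ?B) - cdf X.F x * cdf Y.F y"
  proof -
    have "integrable M (indicat_real A)" if "A \<in> events" for A
      using that by (simp add: integrable_real_indicator less_top[symmetric])
    moreover have "?A \<in> events" "?B \<in> events" "?A \<inter> ?B \<in> events" by simp_all
    moreover have "?A \<inter> ?B \<inter> space M = ?A \<inter> ?B" "?A \<inter> space M = ?A" "?B \<inter> space M = ?B" by auto
    ultimately show ?thesis
      unfolding cdf_X_eq_prob cdf_Y_eq_prob by (simp add: prob_space)
  qed
  also have "?A \<inter> ?B = {w \<in> space M. X w \<le> x \<and> Y w \<le> y}" by auto
  finally show ?thesis by (simp add: joint_cdf_eq_prob)
qed

text \<open>
  Both expectations over independent copies and integrals over the plane factorise: integrating
  the product of the four centred indicators first over \<open>(x, y)\<close> gives the product of the two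
  kernels, and first over the two copies gives the squared defect.
\<close>

lemma
  shows integrable_defect_sq: "integrable lborel (\<lambda>(x, y). (defect x y)\<^sup>2)"
    and bergsma_cov_eq_integral_defect_sq:
      "bergsma_cov M X Y = (LINT q|lborel. (defect (fst q) (snd q))\<^sup>2)"
proof -
  interpret MML: pair_sigma_finite "M \<Otimes>\<^sub>M M" "lborel :: (real \<times> real) measure" ..
  let ?u = "\<lambda>w x. centred_indicator X.F (X w) x" and ?v = "\<lambda>w y. centred_indicator Y.F (Y w) y"
  let ?t = "\<lambda>w q. ?u w (fst q) * ?v w (snd q)"
  have [measurable_cong]: "sets (lborel :: (real \<times> real) measure) = sets (borel \<Otimes>\<^sub>M borel)"
    by (simp only: borel_prod sets_lborel)
  have tensor: "integrable lborel (\<lambda>q. a (fst q) * b (snd q))"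
    "(LINT q|lborel. a (fst q) * b (snd q)) = (LINT x|lborel. a x) * (LINT y|lborel. b y)"
    if "integrable lborel a" "integrable lborel b" for a b :: "real \<Rightarrow> real"
    using lborel_pair.integrable_tensor[OF that] lborel_pair.integral_tensor[OF that]
    by (simp_all add: lborel_prod)
  \<comment> \<open>The dominating function takes \<open>X\<close> from the first copy and \<open>Y\<close> from the second: these are
    independent, so integrability of each \<open>g\<close> separately suffices.\<close>
  have dom: "integrable ((M \<Otimes>\<^sub>M M) \<Otimes>\<^sub>M lborel) (\<lambda>(p, q). ?u (fst p) (fst q) * ?v (snd p) (snd q))"
  proof (rule MML.Fubini_integrable)
    have "integrable (M \<Otimes>\<^sub>M M) (\<lambda>p. (LINT x|lborel. \<bar>?u (fst p) x\<bar>) * (LINT y|lborel. \<bar>?v (snd p) y\<bar>))"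
    proof (rule Bochner_Integration.integrable_bound)
      show "integrable (M \<Otimes>\<^sub>M M) (\<lambda>p. g_fun X.F (X (fst p)) * g_fun Y.F (Y (snd p)))"
        by (rule X.MM.integrable_tensor[OF L2_integrable[OF X.L2_g_fun] L2_integrable[OF Y.L2_g_fun]])
    qed (auto simp: abs_mult intro!: mult_mono X.law.integral_abs_centred_indicator_le
        Y.law.integral_abs_centred_indicator_le X.law.g_fun_nonneg intro: order_trans[OF _ abs_ge_self])
    moreover have "(LINT q|lborel. \<bar>?u w (fst q)\<bar> * \<bar>?v w' (snd q)\<bar>) =
        (LINT x|lborel. \<bar>?u w x\<bar>) * (LINT y|lborel. \<bar>?v w' y\<bar>)" for w w'
      by (rule tensor(2))
        (intro integrable_abs X.law.integrable_centred_indicator Y.law.integrable_centred_indicator)+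
    ultimately show "integrable (M \<Otimes>\<^sub>M M)
        (\<lambda>p. LINT q|lborel. norm (case (p, q) of (p, q) \<Rightarrow> ?u (fst p) (fst q) * ?v (snd p) (snd q)))"
      by (simp add: abs_mult)
  qed (auto intro!: tensor X.law.integrable_centred_indicator Y.law.integrable_centred_indicator)
  have int: "integrable ((M \<Otimes>\<^sub>M M) \<Otimes>\<^sub>M lborel) (\<lambda>(p, q). ?t (fst p) q * ?t (snd p) q)"
  proof (rule Bochner_Integration.integrable_bound[OF dom])
    have "\<bar>?t (fst p) q * ?t (snd p) q\<bar> \<le> \<bar>?u (fst p) (fst q) * ?v (snd p) (snd q)\<bar>" for p q
    proof -
      have "\<bar>?t (fst p) q * ?t (snd p) q\<bar> =
          \<bar>?u (fst p) (fst q) * ?v (snd p) (snd q)\<bar> * (\<bar>?u (snd p) (fst q)\<bar> * \<bar>?v (fst p) (snd q)\<bar>)"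
        by (simp add: abs_mult)
      also have "\<dots> \<le> \<bar>?u (fst p) (fst q) * ?v (snd p) (snd q)\<bar> * 1"
        by (intro mult_left_mono mult_le_one X.law.abs_centred_indicator_le_1
            Y.law.abs_centred_indicator_le_1) auto
      finally show ?thesis by simp
    qed
    then show "AE r in (M \<Otimes>\<^sub>M M) \<Otimes>\<^sub>M lborel.
        norm (case r of (p, q) \<Rightarrow> ?t (fst p) q * ?t (snd p) q) \<le>
        norm (case r of (p, q) \<Rightarrow> ?u (fst p) (fst q) * ?v (snd p) (snd q))"
      by (auto simp: case_prod_unfold)
  qed measurable
  have "integrable M (\<lambda>w. ?t w q)" for q
    by (rule integrable_const_bound[of _ 1])
      (auto simp: abs_mult intro!: mult_le_one X.law.abs_centred_indicator_le_1
        Y.law.abs_centred_indicator_le_1)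
  then have sq: "(LINT p|(M \<Otimes>\<^sub>M M). ?t (fst p) q * ?t (snd p) q) = (defect (fst q) (snd q))\<^sup>2" for q
    by (subst X.MM.integral_tensor) (auto simp: integral_centred_indicators power2_eq_square)
  show "integrable lborel (\<lambda>(x, y). (defect x y)\<^sup>2)"
    using MML.integrable_snd[OF int] unfolding sq by (simp add: case_prod_unfold)
  have "bergsma_cov M X Y = (LINT p|(M \<Otimes>\<^sub>M M). LINT q|lborel. ?t (fst p) q * ?t (snd p) q)"
    unfolding bergsma_cov_def
  proof (intro Bochner_Integration.integral_cong refl)
    fix p
    have *: "integrable lborel (\<lambda>x. ?u (fst p) x * ?u (snd p) x)"
      "integrable lborel (\<lambda>x. ?v (fst p) x * ?v (snd p) x)"
      by (rule Bochner_Integration.integrable_bound[OF X.law.integrable_centred_indicator[of "X (fst p)"]]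
        Bochner_Integration.integrable_bound[OF Y.law.integrable_centred_indicator[of "Y (fst p)"]];
        auto simp: abs_mult intro!: mult_left_le X.law.abs_centred_indicator_le_1
        Y.law.abs_centred_indicator_le_1)+
    show "h_fun X.F (X (fst p)) (X (snd p)) * h_fun Y.F (Y (fst p)) (Y (snd p)) =
        (LINT q|lborel. ?t (fst p) q * ?t (snd p) q)"
      using tensor(2)[OF *] unfolding X.law.h_fun_eq_integral_centred_indicator
        Y.law.h_fun_eq_integral_centred_indicator by (simp add: mult_ac)
  qed
  also have "\<dots> = (LINT q|lborel. LINT p|(M \<Otimes>\<^sub>M M). ?t (fst p) q * ?t (snd p) q)"
    by (rule MML.Fubini_integral[OF int, symmetric])
  finally show "bergsma_cov M X Y = (LINT q|lborel. (defect (fst q) (snd q))\<^sup>2)"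
    unfolding sq .
qed

lemma bergsma_cov_eq_iterated_integral:
  "bergsma_cov M X Y = (LINT x|lborel. LINT y|lborel. (defect x y)\<^sup>2)"
  using lborel_pair.integral_fst'[of "\<lambda>(x, y). (defect x y)\<^sup>2"] integrable_defect_sq
  by (simp add: lborel_prod bergsma_cov_eq_integral_defect_sq case_prod_unfold)

text \<open>
  An increment of the joint distribution function is at most the sum of the marginal increments, so
  it inherits right-continuity from the marginals.
\<close>

lemma joint_cdf_increment:
  assumes "x \<le> x'" "y \<le> y'"
  shows "joint_cdf H x y \<le> joint_cdf H x' y'"
    and "joint_cdf H x' y' \<le> joint_cdf H x y + (cdf X.F x' - cdf X.F x) + (cdf Y.F y' - cdf Y.F y)"
proof -
  let ?J = "\<lambda>x y. {w \<in> space M. X w \<le> x \<and> Y w \<le> y}"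
  let ?A = "\<lambda>x. {w \<in> space M. X w \<le> x}" and ?B = "\<lambda>y. {w \<in> space M. Y w \<le> y}"
  show "joint_cdf H x y \<le> joint_cdf H x' y'"
    unfolding joint_cdf_eq_prob using assms by (intro finite_measure_mono) auto
  have "prob (?J x' y') \<le> prob (?J x y \<union> ((?A x' - ?A x) \<union> (?B y' - ?B y)))"
    by (intro finite_measure_mono) auto
  also have "\<dots> \<le> prob (?J x y) + (prob (?A x' - ?A x) + prob (?B y' - ?B y))"
    by (intro order_trans[OF measure_Un_le] add_left_mono measure_Un_le) auto
  also have "prob (?A x' - ?A x) = prob (?A x') - prob (?A x)"
    by (rule finite_measure_Diff) (use assms in auto)
  also have "prob (?B y' - ?B y) = prob (?B y') - prob (?B y)"
    by (rule finite_measure_Diff) (use assms in auto)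
  finally show "joint_cdf H x' y' \<le> joint_cdf H x y + (cdf X.F x' - cdf X.F x) + (cdf Y.F y' - cdf Y.F y)"
    unfolding joint_cdf_eq_prob cdf_X_eq_prob cdf_Y_eq_prob by simp
qed

lemma defect_right_continuous:
  assumes x: "filterlim xs (at_right x) sequentially" and y: "filterlim ys (at_right y) sequentially"
  shows "(\<lambda>n. defect (xs n) (ys n)) \<longlonglongrightarrow> defect x y"
proof -
  have X: "(\<lambda>n. cdf X.F (xs n)) \<longlonglongrightarrow> cdf X.F x"
    using X.law.cdf_is_right_cont[of x] x unfolding continuous_within by (rule filterlim_compose)
  have Y: "(\<lambda>n. cdf Y.F (ys n)) \<longlonglongrightarrow> cdf Y.F y"
    using Y.law.cdf_is_right_cont[of y] y unfolding continuous_within by (rule filterlim_compose)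
  have "eventually (\<lambda>n. x \<le> xs n) sequentially" "eventually (\<lambda>n. y \<le> ys n) sequentially"
    using x y by (auto simp: filterlim_at elim: eventually_mono)
  then have ev: "eventually (\<lambda>n. x \<le> xs n \<and> y \<le> ys n) sequentially" by (rule eventually_conj)
  have "(\<lambda>n. joint_cdf H (xs n) (ys n)) \<longlonglongrightarrow> joint_cdf H x y"
  proof (rule tendsto_sandwich)
    show "eventually (\<lambda>n. joint_cdf H x y \<le> joint_cdf H (xs n) (ys n)) sequentially"
      using ev by eventually_elim (auto intro: joint_cdf_increment)
    show "eventually (\<lambda>n. joint_cdf H (xs n) (ys n) \<le>
        joint_cdf H x y + (cdf X.F (xs n) - cdf X.F x) + (cdf Y.F (ys n) - cdf Y.F y)) sequentially"
      using ev by eventually_elim (auto intro: joint_cdf_increment)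
    have "(\<lambda>n. joint_cdf H x y + (cdf X.F (xs n) - cdf X.F x) + (cdf Y.F (ys n) - cdf Y.F y))
        \<longlonglongrightarrow> joint_cdf H x y + (cdf X.F x - cdf X.F x) + (cdf Y.F y - cdf Y.F y)"
      by (intro tendsto_intros X Y)
    then show "(\<lambda>n. joint_cdf H x y + (cdf X.F (xs n) - cdf X.F x) + (cdf Y.F (ys n) - cdf Y.F y))
        \<longlonglongrightarrow> joint_cdf H x y" by simp
  qed simp
  then show ?thesis by (intro tendsto_intros X Y)
qed

text \<open>
  A null set contains no square, so arbitrarily close to the upper right of every point there are
  zeros of the defect; right-continuity transports the value to the point itself.
\<close>

lemma defect_zero_if_AE_zero:
  assumes "AE q in lborel. defect (fst q) (snd q) = 0"
  shows "defect x y = 0"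
proof -
  have "\<exists>x' y'. x < x' \<and> x' < x + 1 / Suc n \<and> y < y' \<and> y' < y + 1 / Suc n \<and> defect x' y' = 0" for n
    by (rule point_of_AE_in_square[OF assms, of "1 / Suc n" x y]) auto
  then have "\<forall>n. \<exists>x'. \<exists>y'. x < x' \<and> x' < x + 1 / Suc n \<and> y < y' \<and> y' < y + 1 / Suc n \<and> defect x' y' = 0"
    by (rule allI)
  from choice[OF this] obtain xs where
    "\<forall>n. \<exists>y'. x < xs n \<and> xs n < x + 1 / Suc n \<and> y < y' \<and> y' < y + 1 / Suc n \<and> defect (xs n) y' = 0"
    by (rule exE)
  from choice[OF this] obtain ys where
    "\<forall>n. x < xs n \<and> xs n < x + 1 / Suc n \<and> y < ys n \<and> ys n < y + 1 / Suc n \<and> defect (xs n) (ys n) = 0"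
    by (rule exE)
  then have *: "x < xs n" "xs n < x + 1 / Suc n" "y < ys n" "ys n < y + 1 / Suc n"
    "defect (xs n) (ys n) = 0" for n
    by simp_all
  have lim: "(\<lambda>n. z + 1 / Suc n) \<longlonglongrightarrow> z" for z :: real
    using tendsto_add[OF tendsto_const LIMSEQ_inverse_real_of_nat, of z] by (simp add: inverse_eq_divide)
  have "xs \<longlonglongrightarrow> x"
    by (rule tendsto_sandwich[OF _ _ tendsto_const lim]) (use * in \<open>auto intro!: always_eventually less_imp_le\<close>)
  moreover have "ys \<longlonglongrightarrow> y"
    by (rule tendsto_sandwich[OF _ _ tendsto_const lim]) (use * in \<open>auto intro!: always_eventually less_imp_le\<close>)
  ultimately have "(\<lambda>n. defect (xs n) (ys n)) \<longlonglongrightarrow> defect x y"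
    by (intro defect_right_continuous) (use *(1,3) in \<open>auto simp: filterlim_at less_imp_neq[THEN not_sym]\<close>)
  then show ?thesis by (simp only: *(5)) (simp add: LIMSEQ_const_iff)
qed

lemma bergsma_cov_eq_0_iff:
  "bergsma_cov M X Y = 0 \<longleftrightarrow> (\<forall>x y. joint_cdf H x y = cdf X.F x * cdf Y.F y)"
proof
  assume "bergsma_cov M X Y = 0"
  then have "AE q in lborel. (defect (fst q) (snd q))\<^sup>2 = 0"
    unfolding bergsma_cov_eq_integral_defect_sq
    by (subst (asm) integral_nonneg_eq_0_iff_AE)
      (use integrable_defect_sq in \<open>auto simp: case_prod_unfold\<close>)
  then show "\<forall>x y. joint_cdf H x y = cdf X.F x * cdf Y.F y"
    using defect_zero_if_AE_zero by auto
qed (simp add: bergsma_cov_eq_integral_defect_sq)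

end

section \<open>Bergsma's covariance\<close>

theorem theorem2:
  fixes M :: "'a measure" and X Y :: "'a \<Rightarrow> real"
    and N :: "'b measure" and X1 Y1 X2 Y2 :: "'b \<Rightarrow> real"
    and F1 F2 :: "real measure" and F12 :: "(real \<times> real) measure"
    and \<kappa> \<mu>1 \<mu>2 \<mu>12 \<mu>3 :: real
  defines "F1 \<equiv> distr M borel X"
    and "F2 \<equiv> distr M borel Y"
    and "F12 \<equiv> distr M borel (\<lambda>w. (X w, Y w))"
    and "\<kappa> \<equiv> bergsma_cov M X Y"
    and "\<mu>1 \<equiv> (LINT w|N. \<bar>X1 w - X2 w\<bar>)"
    and "\<mu>2 \<equiv> (LINT w|N. \<bar>Y1 w - Y2 w\<bar>)"
    and "\<mu>12 \<equiv> (LINT w|N. \<bar>X1 w - X2 w\<bar> * \<bar>Y1 w - Y2 w\<bar>)"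
    and "\<mu>3 \<equiv> (LINT w|M. g_fun F1 (X w) * g_fun F2 (Y w))"
  assumes "prob_space M"
    and "X \<in> borel_measurable M" and "Y \<in> borel_measurable M"
    and "integrable M (\<lambda>w. (X w)\<^sup>2)" and "integrable M (\<lambda>w. (Y w)\<^sup>2)"
    and "prob_space N"
    and "prob_space.indep_var N borel (\<lambda>w. (X1 w, Y1 w)) borel (\<lambda>w. (X2 w, Y2 w))"
    and "distr N borel (\<lambda>w. (X1 w, Y1 w)) = F12"
    and "distr N borel (\<lambda>w. (X2 w, Y2 w)) = F12"
  shows "\<kappa> = (LINT w|N. h_fun F1 (X1 w) (X2 w) * h_fun F2 (Y1 w) (Y2 w)) \<and>
    \<kappa> = 1 / 4 * ((LINT w|M. g_joint F12 (X w) (Y w))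
                - 2 * (LINT w|M. g_fun F1 (X w) * g_fun F2 (Y w))
                + (LINT w|M. g_fun F1 (X w)) * (LINT w|M. g_fun F2 (Y w))) \<and>
    \<kappa> = 1 / 4 * (covariance N (\<lambda>w. \<bar>X1 w - X2 w\<bar>) (\<lambda>w. \<bar>Y1 w - Y2 w\<bar>)
                - 2 * covariance N (\<lambda>w. g_fun F1 (X1 w)) (\<lambda>w. g_fun F2 (Y1 w))) \<and>
    \<kappa> = 1 / 4 * (\<mu>12 - 2 * \<mu>3 + \<mu>1 * \<mu>2) \<and>
    \<kappa> = (LINT x|lborel. LINT y|lborel. (joint_cdf F12 x y - cdf F1 x * cdf F2 y)\<^sup>2) \<and>
    ((\<forall>x y. joint_cdf F12 x y = cdf F1 x * cdf F2 y) \<longleftrightarrow> \<kappa> = 0)"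
proof -
  interpret M: prob_space M by fact
  interpret N: prob_space N by fact
  interpret L2_pair M X Y
    by unfold_locales (simp_all add: L2_def assms)
  let ?B = "borel :: (real \<times> real) measure"
  let ?T = "\<lambda>w. ((X1 w, Y1 w), (X2 w, Y2 w))"
  let ?S = "\<lambda>p. ((X (fst p), Y (fst p)), (X (snd p), Y (snd p)))"
  have W1: "(\<lambda>w. (X1 w, Y1 w)) \<in> measurable N ?B" and W2: "(\<lambda>w. (X2 w, Y2 w)) \<in> measurable N ?B"
    using N.indep_var_rv1 N.indep_var_rv2 assms by blast+
  then have T: "?T \<in> measurable N (?B \<Otimes>\<^sub>M ?B)" by simp
  have S: "?S \<in> measurable (M \<Otimes>\<^sub>M M) (?B \<Otimes>\<^sub>M ?B)" by simp
  have law: "distr N (?B \<Otimes>\<^sub>M ?B) ?T = distr (M \<Otimes>\<^sub>M M) (?B \<Otimes>\<^sub>M ?B) ?S"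
    by (rule iid_copies_distr) (use assms in \<open>simp_all add: F12_def\<close>)
  have transfer: "(LINT w|N. f (?T w)) = (LINT p|(M \<Otimes>\<^sub>M M). f (?S p))"
    if "f \<in> borel_measurable (?B \<Otimes>\<^sub>M ?B)" for f :: "_ \<Rightarrow> real"
    using integral_distr[OF T that] integral_distr[OF S that] by (simp add: law)
  have [measurable_cong]: "sets ?B = sets (borel \<Otimes>\<^sub>M borel)"
    by (simp only: borel_prod)
  define dx :: "(real \<times> real) \<times> (real \<times> real) \<Rightarrow> real"
    where "dx = (\<lambda>t. \<bar>fst (fst t) - fst (snd t)\<bar>)"
  define dy :: "(real \<times> real) \<times> (real \<times> real) \<Rightarrow> real"
    where "dy = (\<lambda>t. \<bar>snd (fst t) - snd (snd t)\<bar>)"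
  have [measurable]: "dx \<in> borel_measurable (?B \<Otimes>\<^sub>M ?B)" "dy \<in> borel_measurable (?B \<Otimes>\<^sub>M ?B)"
    unfolding dx_def dy_def by (auto simp flip: borel_prod)
  have \<mu>1: "\<mu>1 = (LINT w|M. g_fun F1 (X w))"
    unfolding \<mu>1_def F1_def X.integral_abs_diff[symmetric] using transfer[of dx] by (simp add: dx_def)
  have \<mu>2: "\<mu>2 = (LINT w|M. g_fun F2 (Y w))"
    unfolding \<mu>2_def F2_def Y.integral_abs_diff[symmetric] using transfer[of dy] by (simp add: dy_def)
  have \<mu>12: "\<mu>12 = (LINT p|(M \<Otimes>\<^sub>M M). \<bar>X (fst p) - X (snd p)\<bar> * \<bar>Y (fst p) - Y (snd p)\<bar>)"
    unfolding \<mu>12_def using transfer[of "\<lambda>t. dx t * dy t"] by (simp add: dx_def dy_def)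
  have \<kappa>: "\<kappa> = 1 / 4 * (\<mu>12 - 2 * \<mu>3 + \<mu>1 * \<mu>2)"
    unfolding \<kappa>_def bergsma_cov_eq_abs_diff_moments \<mu>1 \<mu>2 \<mu>12 \<mu>3_def F1_def F2_def ..
  have "\<kappa> = (LINT w|N. h_fun F1 (X1 w) (X2 w) * h_fun F2 (Y1 w) (Y2 w))"
    unfolding \<kappa>_def bergsma_cov_def F1_def F2_def
    using transfer[of "\<lambda>t. h_fun X.F (fst (fst t)) (fst (snd t)) * h_fun Y.F (snd (fst t)) (snd (snd t))"]
    by (simp flip: borel_prod)
  moreover have "(LINT w|M. g_joint F12 (X w) (Y w)) = \<mu>12"
    unfolding F12_def \<mu>12 by (rule integral_g_joint)
  moreover have "covariance N (\<lambda>w. \<bar>X1 w - X2 w\<bar>) (\<lambda>w. \<bar>Y1 w - Y2 w\<bar>) = \<mu>12 - \<mu>1 * \<mu>2"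
  proof -
    have "covariance N (\<lambda>w. \<bar>X1 w - X2 w\<bar>) (\<lambda>w. \<bar>Y1 w - Y2 w\<bar>) =
        covariance (M \<Otimes>\<^sub>M M) (\<lambda>p. \<bar>X (fst p) - X (snd p)\<bar>) (\<lambda>p. \<bar>Y (fst p) - Y (snd p)\<bar>)"
      using covariance_comp[OF T, of dx dy] covariance_comp[OF S, of dx dy] law
      by (simp add: dx_def dy_def)
    then show ?thesis
      by (simp add: X.MM.covariance_eq X.L2_abs_diff Y.L2_abs_diff X.integral_abs_diff
          Y.integral_abs_diff \<mu>1 \<mu>2 \<mu>12 F1_def F2_def)
  qed
  moreover have "covariance N (\<lambda>w. g_fun F1 (X1 w)) (\<lambda>w. g_fun F2 (Y1 w)) = \<mu>3 - \<mu>1 * \<mu>2"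
  proof -
    have "covariance N (\<lambda>w. g_fun F1 (X1 w)) (\<lambda>w. g_fun F2 (Y1 w)) =
        covariance M (\<lambda>w. g_fun F1 (X w)) (\<lambda>w. g_fun F2 (Y w))"
      using covariance_comp[OF W1, of "\<lambda>z. g_fun F1 (fst z)" "\<lambda>z. g_fun F2 (snd z)"]
        covariance_comp[OF XY_measurable, of "\<lambda>z. g_fun F1 (fst z)" "\<lambda>z. g_fun F2 (snd z)"]
        assms by (simp flip: borel_prod)
    then show ?thesis
      by (simp add: M.covariance_eq X.L2_g_fun Y.L2_g_fun \<mu>1 \<mu>2 \<mu>3_def F1_def F2_def)
  qed
  ultimately show ?thesis
    using \<kappa> bergsma_cov_eq_iterated_integral bergsma_cov_eq_0_iff
    unfolding \<mu>1[symmetric] \<mu>2[symmetric] \<mu>3_def[symmetric]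
    by (simp add: \<kappa>_def F1_def F2_def F12_def)
qed

end
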